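(* Let $y\in\mathbb{R}$, $b>0$, $\gamma^{(0)}>0$, and let $(\gamma^{(k)})_{k\ge0}$ be generated by the one-dimensional convex bounding (CB) algorithm $$\gamma^{(k+1)}=\gamma^{(k)}\sqrt{\frac{y^2}{b+\gamma^{(k)}}},\qquad k\ge0.$$ (i) If $y^2>b$, then $\gamma^{(k)}$ converges to $\gamma^*=y^2-b$ with order of convergence $p=1$ and rate of convergence $\zeta=\frac{b+y^2}{2y^2}$. (ii) If $y^2<b$, then $\gamma^{(k)}$ converges to $\gamma^*=0$ with order of convergence $p=1$ and rate of convergence $\zeta=\sqrt{\frac{y^2}{b}}$. (iii) If $y^2=b$, then $\gamma^{(k)}$ converges to $\gamma^*=0$ in the rate of $O(1/k)$: $$\frac{2b}{k+\frac{2b}{\gamma^{(0)}}}\le\gamma^{(k)}\le\frac{c_0}{k+\frac{c_0}{\gamma^{(0)}}},\qquad k\ge0,$$ where $c_0=\max\{4b,\sqrt{2b\gamma^{(0)}}\}$.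
   Context: A sequence $\{\gamma^{(k)}\}$ converges to $\gamma^*$ with order of convergence $p$ and rate of convergence $\zeta$ if $\gamma^{(k)}\to\gamma^*$ and $\lim_{k\to\infty}\frac{|\gamma^{(k+1)}-\gamma^*|}{|\gamma^{(k)}-\gamma^*|^p}=\zeta$. The assertion on this limit is understood for sequences with $\gamma^{(k)}\ne\gamma^*$ for all $k$ (so that the quotients are defined); the convergence $\gamma^{(k)}\to\gamma^*$ is asserted in all cases. *)

theory Defs
  imports Complex_Main "HOL-Library.Landau_Symbols"
begin

text \<open>
  The limit of the quotients is only asserted for sequences that never hit the limit point
  (otherwise Isabelle's \<open>x / 0 = 0\<close> would give undefined quotients a value); the
  convergence is asserted in all cases.
\<close>

definition converges_with_order_rate ::
    "(nat \<Rightarrow> real) \<Rightarrow> real \<Rightarrow> real \<Rightarrow> real \<Rightarrow> bool" where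
  "converges_with_order_rate \<gamma> L p \<zeta> \<longleftrightarrow>
     \<gamma> \<longlonglongrightarrow> L \<and>
     ((\<forall>k. \<gamma> k \<noteq> L) \<longrightarrow>
        (\<lambda>k. \<bar>\<gamma> (k + 1) - L\<bar> / \<bar>\<gamma> k - L\<bar> powr p) \<longlonglongrightarrow> \<zeta>)"

definition cb_sequence :: "real \<Rightarrow> real \<Rightarrow> (nat \<Rightarrow> real) \<Rightarrow> bool" where
  "cb_sequence y b \<gamma> \<longleftrightarrow> (\<forall>k. \<gamma> (k + 1) = \<gamma> k * sqrt (y\<^sup>2 / (b + \<gamma> k)))"

end

theory Submission
  imports Defs
begin

text \<open>
  If \<open>y\<^sup>2 > b\<close>, write \<open>r = sqrt (b + x)\<close> and \<open>s = \<bar>y\<bar>\<close>. Then \<open>x - \<gamma>\<^sup>* = r\<^sup>2 - s\<^sup>2\<close>, while the image of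
  \<open>x\<close> differs from \<open>\<gamma>\<^sup>*\<close> by \<open>(r - s) (s + b / r)\<close>. One step therefore multiplies the error by
  \<open>(s + b / r) / (s + r)\<close>, which lies in \<open>(0, 1)\<close>, decreases in \<open>r\<close> and has the value
  \<open>(b + y\<^sup>2) / (2 y\<^sup>2)\<close> at \<open>r = s\<close>; hence the iterates stay above \<open>min \<gamma>\<^sub>0 \<gamma>\<^sup>*\<close>, where the factor is
  bounded away from 1. If \<open>y\<^sup>2 < b\<close>, one step multiplies the iterate by at most
  \<open>sqrt (y\<^sup>2 / b) < 1\<close>. If \<open>y\<^sup>2 = b\<close>, the reciprocals \<open>1 / \<gamma>\<^sub>k\<close> grow per step by
  \<open>1 / (b (1 + sqrt (1 + \<gamma>\<^sub>k / b)))\<close>, which lies between \<open>1 / c\<^sub>0\<close> and \<open>1 / (2 b)\<close>.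
\<close>

section \<open>Convergence from bounds on the error factor\<close>

lemma tendsto_of_contraction:
  fixes \<gamma> :: "nat \<Rightarrow> real"
  assumes "0 \<le> q" "q < 1"
    and step: "\<And>k. \<bar>\<gamma> (Suc k) - L\<bar> \<le> q * \<bar>\<gamma> k - L\<bar>"
  shows "\<gamma> \<longlonglongrightarrow> L"
proof -
  have bound: "norm (\<gamma> k - L) \<le> q ^ k * \<bar>\<gamma> 0 - L\<bar>" for k
  proof (induction k)
    case (Suc k)
    have "\<bar>\<gamma> (Suc k) - L\<bar> \<le> q * (q ^ k * \<bar>\<gamma> 0 - L\<bar>)"
      using step[of k] Suc mult_left_mono[OF _ \<open>0 \<le> q\<close>] by fastforce
    then show ?case by (simp add: mult.assoc)
  qed simp
  have "(\<lambda>k. q ^ k * \<bar>\<gamma> 0 - L\<bar>) \<longlonglongrightarrow> 0"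
    using assms by (intro tendsto_mult_left_zero LIMSEQ_power_zero) auto
  then have "(\<lambda>k. \<gamma> k - L) \<longlonglongrightarrow> 0"
    by (rule tendsto_0_le[where K = 1]) (use bound \<open>0 \<le> q\<close> in \<open>simp add: abs_mult\<close>)
  then show ?thesis by (simp add: LIM_zero_iff)
qed

text \<open>Using a factor \<open>c\<close> instead of the quotient keeps the step equation
  meaningful when an iterate equals \<open>L\<close>; the two are identified only for sequences that
  avoid \<open>L\<close>.\<close>

lemma converges_with_order_one:
  assumes "\<gamma> \<longlonglongrightarrow> L" "c \<longlonglongrightarrow> \<zeta>"
    and step: "\<And>k. \<bar>\<gamma> (Suc k) - L\<bar> = c k * \<bar>\<gamma> k - L\<bar>"
  shows "converges_with_order_rate \<gamma> L 1 \<zeta>"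
proof -
  have "(\<lambda>k. \<bar>\<gamma> (k + 1) - L\<bar> / \<bar>\<gamma> k - L\<bar> powr 1) = c" if "\<forall>k. \<gamma> k \<noteq> L"
    using that by (auto simp: step fun_eq_iff)
  with assms show ?thesis
    by (simp add: converges_with_order_rate_def)
qed

section \<open>The case \<open>y\<^sup>2 > b\<close>\<close>

definition cb_factor :: "real \<Rightarrow> real \<Rightarrow> real \<Rightarrow> real" where
  "cb_factor y b x = (\<bar>y\<bar> + b / sqrt (b + x)) / (\<bar>y\<bar> + sqrt (b + x))"

text \<open>The identity is signed, so that with a factor in [0, 1] the new iterate is a convex
  combination of the old one and \<open>y\<^sup>2 - b\<close>.\<close>

lemma cb_step_error:
  assumes "b > 0" "x \<ge> 0"
  shows "x * sqrt (y\<^sup>2 / (b + x)) - (y\<^sup>2 - b) = cb_factor y b x * (x - (y\<^sup>2 - b))"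
proof -
  define r s where "r = sqrt (b + x)" and "s = \<bar>y\<bar>"
  have r: "r > 0" "s \<ge> 0" "x = r\<^sup>2 - b" "y\<^sup>2 = s\<^sup>2"
    using assms by (auto simp: r_def s_def)
  have "x * sqrt (y\<^sup>2 / (b + x)) - (y\<^sup>2 - b) = (r\<^sup>2 - b) * (s / r) - (s\<^sup>2 - b)"
    using r by (simp add: real_sqrt_divide)
  also have "\<dots> = (r - s) * (s + b / r)"
    using r by (simp add: field_simps power2_eq_square)
  also have "\<dots> = (s + b / r) / (s + r) * (r\<^sup>2 - s\<^sup>2)"
    using r by (simp add: divide_simps add_nonneg_eq_0_iff) (simp add: algebra_simps power2_eq_square)
  finally show ?thesis
    using r by (simp add: cb_factor_def flip: r_def s_def)
qed

lemma cb_factor_nonneg: "b > 0 \<Longrightarrow> x \<ge> 0 \<Longrightarrow> 0 \<le> cb_factor y b x"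
  by (simp add: cb_factor_def)

lemma cb_factor_less_one:
  assumes "b > 0" "x > 0"
  shows "cb_factor y b x < 1"
proof -
  have "b / sqrt (b + x) < (b + x) / sqrt (b + x)"
    using assms by (intro divide_strict_right_mono) auto
  also have "\<dots> = sqrt (b + x)"
    using assms by (simp add: real_div_sqrt)
  finally show ?thesis
    using assms by (simp add: cb_factor_def add_nonneg_pos)
qed

lemma cb_factor_antimono:
  assumes "b > 0" "0 \<le> m" "m \<le> x"
  shows "cb_factor y b x \<le> cb_factor y b m"
  unfolding cb_factor_def
  using assms by (intro frac_le add_mono divide_left_mono order.refl) (auto simp: add_nonneg_pos)

lemma cb_factor_fixed_point:
  assumes "y \<noteq> 0"
  shows "cb_factor y b (y\<^sup>2 - b) = (b + y\<^sup>2) / (2 * y\<^sup>2)"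
proof -
  have "y\<^sup>2 = \<bar>y\<bar> * \<bar>y\<bar>" by (simp add: power2_eq_square)
  then show ?thesis
    using assms by (simp add: cb_factor_def field_simps)
qed

lemma cb_supercritical:
  assumes "b > 0" "\<gamma> 0 > 0" "cb_sequence y b \<gamma>" "y\<^sup>2 > b"
  shows "converges_with_order_rate \<gamma> (y\<^sup>2 - b) 1 ((b + y\<^sup>2) / (2 * y\<^sup>2))"
proof -
  define L where "L = y\<^sup>2 - b"
  define m where "m = min (\<gamma> 0) L"
  have m: "m > 0" "m \<le> L" using assms by (auto simp: m_def L_def)
  have "y \<noteq> 0" using assms by auto
  have rec: "\<gamma> (Suc k) - L = cb_factor y b (\<gamma> k) * (\<gamma> k - L)" if "\<gamma> k \<ge> 0" for k
    using assms cb_step_error[OF \<open>b > 0\<close> that, of y] by (simp add: cb_sequence_def L_def)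
  have ge: "m \<le> \<gamma> k" for k
  proof (induction k)
    case 0
    show ?case by (simp add: m_def)
  next
    case (Suc k)
    define c where "c = cb_factor y b (\<gamma> k)"
    have c: "0 \<le> c" "c \<le> 1"
      using cb_factor_nonneg[of b "\<gamma> k" y] cb_factor_less_one[of b "\<gamma> k" y] Suc m assms
      by (auto simp: c_def)
    \<comment> \<open>A convex combination of two numbers that are at least \<open>m\<close> is at
      least \<open>m\<close>.\<close>
    have "m = c * m + (1 - c) * m" by (simp add: algebra_simps)
    also have "\<dots> \<le> c * \<gamma> k + (1 - c) * L"
      using c m Suc by (intro add_mono mult_left_mono) auto
    also have "\<dots> = \<gamma> (Suc k)"
      using rec[of k] Suc m by (simp add: c_def algebra_simps)
    finally show ?case .
  qed
  have pos: "\<gamma> k \<ge> 0" for k using ge[of k] m by simp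
  have abs_rec: "\<bar>\<gamma> (Suc k) - L\<bar> = cb_factor y b (\<gamma> k) * \<bar>\<gamma> k - L\<bar>" for k
    using rec[OF pos] cb_factor_nonneg[OF \<open>b > 0\<close> pos] by (simp add: abs_mult)
  have lim: "\<gamma> \<longlonglongrightarrow> L"
  proof (rule tendsto_of_contraction)
    show "0 \<le> cb_factor y b m" "cb_factor y b m < 1"
      using cb_factor_nonneg[of b m y] cb_factor_less_one[of b m y] m assms by auto
    show "\<bar>\<gamma> (Suc k) - L\<bar> \<le> cb_factor y b m * \<bar>\<gamma> k - L\<bar>" for k
      unfolding abs_rec using ge m assms by (intro mult_right_mono cb_factor_antimono) auto
  qed
  \<comment> \<open>Continuity at \<open>L\<close>: since \<open>b + L = y\<^sup>2\<close> and
    \<open>y\<close> is nonzero, both denominators have nonzero limits.\<close>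
  have "(\<lambda>k. cb_factor y b (\<gamma> k)) \<longlonglongrightarrow> cb_factor y b L"
    unfolding cb_factor_def using lim \<open>y \<noteq> 0\<close>
    by (intro tendsto_intros) (auto simp: L_def)
  then show ?thesis
    using converges_with_order_one[OF lim _ abs_rec] cb_factor_fixed_point[OF \<open>y \<noteq> 0\<close>, of b]
    by (simp add: L_def)
qed

section \<open>The case \<open>y\<^sup>2 < b\<close>\<close>

lemma cb_nonneg:
  assumes "b > 0" "\<gamma> 0 > 0" "cb_sequence y b \<gamma>"
  shows "0 \<le> \<gamma> k"
  using assms by (induction k) (auto simp: cb_sequence_def)

lemma cb_subcritical:
  assumes "b > 0" "\<gamma> 0 > 0" "cb_sequence y b \<gamma>" "y\<^sup>2 < b"
  shows "converges_with_order_rate \<gamma> 0 1 (sqrt (y\<^sup>2 / b))"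
proof -
  \<comment> \<open>Strict positivity can fail: for \<open>y = 0\<close> every iterate after
    \<open>\<gamma> 0\<close> is 0.\<close>
  note pos = cb_nonneg[OF assms(1-3)]
  have abs_rec: "\<bar>\<gamma> (Suc k) - 0\<bar> = sqrt (y\<^sup>2 / (b + \<gamma> k)) * \<bar>\<gamma> k - 0\<bar>" for k
    using assms pos[of k] by (simp add: cb_sequence_def abs_mult)
  have lim: "\<gamma> \<longlonglongrightarrow> 0"
  proof (rule tendsto_of_contraction)
    show "0 \<le> sqrt (y\<^sup>2 / b)" "sqrt (y\<^sup>2 / b) < 1" using assms by auto
    show "\<bar>\<gamma> (Suc k) - 0\<bar> \<le> sqrt (y\<^sup>2 / b) * \<bar>\<gamma> k - 0\<bar>" for k
      unfolding abs_rec using pos[of k] assms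
      by (intro mult_right_mono real_sqrt_le_mono divide_left_mono) (auto simp: add_pos_nonneg)
  qed
  have "(\<lambda>k. sqrt (y\<^sup>2 / (b + \<gamma> k))) \<longlonglongrightarrow> sqrt (y\<^sup>2 / (b + 0))"
    using lim assms by (intro tendsto_intros) auto
  then show ?thesis
    using converges_with_order_one[OF lim _ abs_rec] by simp
qed

section \<open>The case \<open>y\<^sup>2 = b\<close>\<close>

lemma cb_critical_pos:
  assumes "b > 0" "\<gamma> 0 > 0" "cb_sequence y b \<gamma>" "y\<^sup>2 = b"
  shows "0 < \<gamma> k"
  using assms by (induction k) (auto simp: cb_sequence_def)

lemma cb_critical_inverse_step:
  assumes "b > 0" "x > 0"
  shows "1 / (x * sqrt (b / (b + x))) - 1 / x = 1 / (b * (1 + sqrt (1 + x / b)))"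
proof -
  \<comment> \<open>In terms of \<open>r\<close> the increment is (r - 1) / (b (r^2 - 1)), and the
    factor r - 1 cancels.\<close>
  define r where "r = sqrt (1 + x / b)"
  have r: "r > 1" "x = b * (r\<^sup>2 - 1)" using assms by (auto simp: r_def)
  have "b / (b + x) = 1 / (1 + x / b)" using assms by (simp add: field_simps)
  then have "sqrt (b / (b + x)) = 1 / r" by (simp add: r_def real_sqrt_divide)
  then have "1 / (x * sqrt (b / (b + x))) - 1 / x = (r - 1) / x"
    by (simp add: diff_divide_distrib)
  also have "\<dots> = (r - 1) / (b * ((r - 1) * (1 + r)))"
    unfolding r(2) by (simp add: algebra_simps power2_eq_square)
  also have "\<dots> = 1 / (b * (1 + r))" using r(1) by simp
  finally show ?thesis by (simp add: r_def)
qed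

lemma cb_critical_constant:
  assumes "b > 0" "x > 0"
  shows "b * (1 + sqrt (1 + x / b)) \<le> max (4 * b) (sqrt (2 * b * x))"
\<comment> \<open>At \<open>x = 8 * b\<close> both terms of the maximum, and the left-hand side too,
  equal \<open>4 * b\<close>.\<close>
proof (cases "x / b \<le> 8")
  case True
  then have "sqrt (1 + x / b) \<le> sqrt (3\<^sup>2)" by (intro real_sqrt_le_mono) simp
  then show ?thesis using assms by (simp add: le_max_iff_disj)
next
  case False
  define t where "t = x / b"
  have t: "t > 8" "x = b * t" using False assms by (auto simp: t_def)
  have "8 * t \<le> t * t" using t by (intro mult_right_mono) auto
  \<comment> \<open>The target, squared, reads 2 + t + 2 sqrt (1 + t) <= 2 t, that is, sqrt (1 + t)
    <= (t - 2) / 2; squaring again leaves 8 t <= t^2.\<close>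
  then have "sqrt (1 + t) \<le> sqrt (((t - 2) / 2)\<^sup>2)"
    by (intro real_sqrt_le_mono) (simp add: field_simps power2_eq_square)
  then have "2 * sqrt (1 + t) \<le> t - 2" using t by simp
  then have "(1 + sqrt (1 + t))\<^sup>2 \<le> 2 * t" using t by (simp add: power2_sum)
  then have "1 + sqrt (1 + t) \<le> sqrt (2 * t)" by (rule real_le_rsqrt)
  then have "b * (1 + sqrt (1 + t)) \<le> b * sqrt (2 * t)" using assms by simp
  also have "\<dots> = sqrt (2 * b * x)"
    using assms by (simp add: t(2) real_sqrt_mult)
  finally show ?thesis by (simp add: t_def)
qed

lemma cb_critical_bounds:
  assumes "b > 0" "\<gamma> 0 > 0" "cb_sequence y b \<gamma>" "y\<^sup>2 = b"
  defines "c0 \<equiv> max (4 * b) (sqrt (2 * b * \<gamma> 0))"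
  shows "2 * b / (real k + 2 * b / \<gamma> 0) \<le> \<gamma> k" "\<gamma> k \<le> c0 / (real k + c0 / \<gamma> 0)"
proof -
  note pos = cb_critical_pos[OF assms(1-4)]
  have c0: "c0 > 0" using assms by (auto simp: less_max_iff_disj)
  have rec: "\<gamma> (Suc k) = \<gamma> k * sqrt (b / (b + \<gamma> k))" for k
    using assms by (simp add: cb_sequence_def)
  have inv_rec: "1 / \<gamma> (Suc k) = 1 / \<gamma> k + 1 / (b * (1 + sqrt (1 + \<gamma> k / b)))" for k
    using cb_critical_inverse_step[OF \<open>b > 0\<close> pos[of k]] by (simp add: rec)
  \<comment> \<open>The increment of the reciprocals is smallest at the largest iterate, so this
    monotonicity allows a constant \<open>c0\<close> that depends on \<open>\<gamma> 0\<close>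
    alone.\<close>
  have le0: "\<gamma> k \<le> \<gamma> 0" for k
  proof (induction k)
    case (Suc k)
    have "\<gamma> (Suc k) \<le> \<gamma> k * 1"
      unfolding rec using assms pos[of k] by (intro mult_left_mono) auto
    with Suc show ?case by simp
  qed simp
  have incr: "1 / c0 \<le> 1 / (b * (1 + sqrt (1 + \<gamma> k / b)))"
    "1 / (b * (1 + sqrt (1 + \<gamma> k / b))) \<le> 1 / (2 * b)" for k
  proof -
    have one: "1 \<le> sqrt (1 + \<gamma> k / b)"
      using pos[of k] assms by simp
    have den: "0 < b * (1 + sqrt (1 + \<gamma> k / b))"
      using one assms(1) by (intro mult_pos_pos) linarith+
    have "b * (1 + sqrt (1 + \<gamma> k / b)) \<le> b * (1 + sqrt (1 + \<gamma> 0 / b))"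
      using le0[of k] assms by (simp add: divide_right_mono)
    also have "\<dots> \<le> c0"
      unfolding c0_def using assms by (intro cb_critical_constant)
    finally show "1 / c0 \<le> 1 / (b * (1 + sqrt (1 + \<gamma> k / b)))"
      using den by (intro frac_le) auto
    have "2 * b \<le> b * (1 + sqrt (1 + \<gamma> k / b))"
      using one assms by simp
    then show "1 / (b * (1 + sqrt (1 + \<gamma> k / b))) \<le> 1 / (2 * b)"
      using assms by (intro frac_le) auto
  qed
  have inv: "1 / \<gamma> 0 + real k / c0 \<le> 1 / \<gamma> k \<and> 1 / \<gamma> k \<le> 1 / \<gamma> 0 + real k / (2 * b)"
  proof (induction k)
    case (Suc k)
    with incr[of k] inv_rec[of k] show ?case
      by (auto simp: add_divide_distrib)
  qed simp
  have flip: "c / (real k + c / \<gamma> 0) = 1 / (1 / \<gamma> 0 + real k / c)" if "c > 0" for c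
    using that assms by (simp add: divide_simps add_nonneg_pos)
  have "1 / (1 / \<gamma> 0 + real k / (2 * b)) \<le> 1 / (1 / \<gamma> k)"
    using inv pos[of k] by (intro frac_le) auto
  then show "2 * b / (real k + 2 * b / \<gamma> 0) \<le> \<gamma> k"
    using flip[of "2 * b"] assms by simp
  have "1 / (1 / \<gamma> k) \<le> 1 / (1 / \<gamma> 0 + real k / c0)"
    using inv \<open>\<gamma> 0 > 0\<close> c0 by (intro frac_le) (auto intro: add_pos_nonneg)
  then show "\<gamma> k \<le> c0 / (real k + c0 / \<gamma> 0)"
    using flip[OF c0] by simp
qed

lemma cb_critical:
  assumes "b > 0" "\<gamma> 0 > 0" "cb_sequence y b \<gamma>" "y\<^sup>2 = b"
  shows "\<gamma> \<longlonglongrightarrow> 0" "\<gamma> \<in> O(\<lambda>k. 1 / real k)"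
proof -
  define c0 where "c0 = max (4 * b) (sqrt (2 * b * \<gamma> 0))"
  have c0: "c0 > 0" using assms by (auto simp: c0_def less_max_iff_disj)
  note pos = cb_critical_pos[OF assms]
  \<comment> \<open>At \<open>k = 0\<close> the right-hand side is 0 by the convention for division,
    and the bound fails.\<close>
  have "norm (\<gamma> k) \<le> c0 / real k" if "k > 0" for k
  proof -
    have "c0 / (real k + c0 / \<gamma> 0) \<le> c0 / real k"
      using that c0 assms by (intro divide_left_mono) (auto intro!: mult_pos_pos add_pos_nonneg)
    then show ?thesis
      using cb_critical_bounds(2)[OF assms, of k] pos[of k] that by (simp flip: c0_def)
  qed
  then have bound: "eventually (\<lambda>k. norm (\<gamma> k) \<le> c0 / real k) sequentially"
    by (rule eventually_sequentiallyI[of 1]) simp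
  then show "\<gamma> \<in> O(\<lambda>k. 1 / real k)"
    by (intro bigoI[of _ c0]) simp
  show "\<gamma> \<longlonglongrightarrow> 0"
    using lim_const_over_n[of c0]
    by (rule tendsto_0_le[where K = 1]) (use bound c0 in simp)
qed

theorem proposition4p3:
  fixes y b :: real and \<gamma> :: "nat \<Rightarrow> real"
  assumes "b > 0" and "\<gamma> 0 > 0" and "cb_sequence y b \<gamma>"
  shows "(y\<^sup>2 > b \<longrightarrow>
            converges_with_order_rate \<gamma> (y\<^sup>2 - b) 1 ((b + y\<^sup>2) / (2 * y\<^sup>2))) \<and>
         (y\<^sup>2 < b \<longrightarrow>
            converges_with_order_rate \<gamma> 0 1 (sqrt (y\<^sup>2 / b))) \<and>
         (y\<^sup>2 = b \<longrightarrow>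
            \<gamma> \<longlonglongrightarrow> 0 \<and>
            \<gamma> \<in> O(\<lambda>k. 1 / real k) \<and>
            (let c0 = max (4 * b) (sqrt (2 * b * \<gamma> 0)) in
               \<forall>k. 2 * b / (real k + 2 * b / \<gamma> 0) \<le> \<gamma> k \<and>
                   \<gamma> k \<le> c0 / (real k + c0 / \<gamma> 0)))"
  using cb_supercritical[OF assms] cb_subcritical[OF assms] cb_critical[OF assms]
    cb_critical_bounds[OF assms]
  by (simp add: Let_def)

end
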